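(* Let $G$ be a distance-regular graph of diameter $d$ and valency $k$, with intersection numbers $a_i,b_i,c_i$ ($0\le i\le d$). Let $q$ be an integer with $1\le q\le d-1$ such that $a_{q-1}=0$, $c_{q+1}>c_q$ and $c_{q+1}\ge a_q$. Then, for any integer $p$ with $0\le p\le d$, we have $$d\le 2p-1+\max\left\{0,\left(\left\lfloor\frac{2(b_p-c_p)}{2c_q+M}\right\rfloor+1\right)q\right\},$$ where $$M=\left\lceil\frac{a_q(c_{q+1}-a_q)}{c_{q+1}-c_q}\right\rceil.$$
   Context: Graphs are simple and undirected; ${\rm d}(x,y)$ is the graph distance. For a vertex $x$, $S_h(x)$ is the set of vertices at distance exactly $h$ from $x$ (with $S_{-1}(x)=S_{d+1}(x)=\emptyset$, where $d$ is the diameter). A finite connected graph $G$ of diameter $d$ is called distance-regular if there are integers $b_i,c_i$, $0\le i\le d$, such that for any two vertices $x,y$ at distance $i$ one has $|S_{i+1}(x)\cap S_1(y)|=b_i$ and $|S_{i-1}(x)\cap S_1(y)|=c_i$. Such a graph is regular of valency $k=b_0$, with $b_d=c_0=0$ and $c_1=1$, and one sets $a_i=k-b_i-c_i=|S_i(x)\cap S_1(y)|$ for ${\rm d}(x,y)=i$. *)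

theory Defs
  imports Complex_Main "Graph_Theory.Graph_Theory"
begin

(* A simple undirected graph is a pair_graph: finite, loop-free, with a symmetric set of arcs
   (u,v), so that an edge uv is the pair of arcs (u,v), (v,u). *)

(* Only meaningful if y is reachable from x; below the graph is always connected. *)
definition gdist :: "'a pair_pre_digraph \<Rightarrow> 'a \<Rightarrow> 'a \<Rightarrow> nat" where
  "gdist G x y = (LEAST n. \<exists>p. pre_digraph.awalk (with_proj G) x p y \<and> length p = n)"

definition diameter :: "'a pair_pre_digraph \<Rightarrow> nat" where
  "diameter G = Max {gdist G x y | x y. x \<in> pverts G \<and> y \<in> pverts G}"

(* The radius is an integer, so that the sphere of radius -1 is empty. *)
definition gsphere :: "'a pair_pre_digraph \<Rightarrow> int \<Rightarrow> 'a \<Rightarrow> 'a set" where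
  "gsphere G h x = {y \<in> pverts G. int (gdist G x y) = h}"

(* G is distance-regular with intersection numbers b i, c i for 0 <= i <= diameter G;
   the values of b and c beyond the diameter are irrelevant.
   The constant connected of the digraph library (not the topological one of the same base name)
   includes nonemptiness of the vertex set. *)
definition distance_regular ::
    "'a pair_pre_digraph \<Rightarrow> (nat \<Rightarrow> int) \<Rightarrow> (nat \<Rightarrow> int) \<Rightarrow> bool" where
  "distance_regular G b c \<longleftrightarrow>
     pair_graph G \<and> Digraph_Component.connected (with_proj G) \<and>
     (\<forall>i \<le> diameter G. \<forall>x \<in> pverts G. \<forall>y \<in> pverts G. gdist G x y = i \<longrightarrow>
        int (card (gsphere G (int i + 1) x \<inter> gsphere G 1 y)) = b i \<and>
        int (card (gsphere G (int i - 1) x \<inter> gsphere G 1 y)) = c i)"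

end

(* Along a geodesic take x, y, z with d(x,y) = i, d(y,z) = q, d(x,z) = i + q. Put f(u) = d(x,u) - i
   for u adjacent to y and g(v) = d(x,v) - i - q for v adjacent to z, so that f sums to b_i - c_i and
   g to b_{i+q} - c_{i+q}. The neighbours of y that are closer to z have f = 1 and those of z that are
   closer to y have g = -1; together they contribute 2 c_q to the difference of the sums. On the other
   neighbours (the sets far z y and far y z, containing the a_q vertices at distance exactly q) one
   double-counts the pairs (u,v): if d(u,v) = q then f(u) >= g(v), and if d(u,v) = q - 1 then
   f(u) >= g(v) + 1. Since a_{q-1} = 0, the bipartite graph of pairs at distance q has degree a_q - c_q
   at the vertices at distance exactly q and degree c_{q+1} - c_q elsewhere, while the pairs at distance
   q - 1 form a c_q-regular graph on the former. Hence these neighbours contribute at least M, i.e.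
   b_i - c_i drops by at least 2 c_q + M every q steps. Starting at i = p, it never falls
   below -(b_p - c_p) before i = d - p, because c_i <= b_j whenever i + j <= d. *)

theory Submission
  imports Defs
begin

section \<open>Distance-regularity expressed by the metric alone\<close>

text \<open>Apart from the counts \<open>b\<close> and \<open>c\<close>, the argument uses only a
  metric whose geodesics can be cut at any point (\<open>D_split\<close>), so walks are confined to
  the interpretation. \<open>card_down\<close> adds 1 on one side to avoid truncated
  subtraction.\<close>

locale drg_metric =
  fixes V :: "'a set" and D :: "'a \<Rightarrow> 'a \<Rightarrow> nat" and b c :: "nat \<Rightarrow> int" and d :: nat
  assumes finite_V: "finite V"
    and D_eq_0_iff: "\<lbrakk>x \<in> V; y \<in> V\<rbrakk> \<Longrightarrow> D x y = 0 \<longleftrightarrow> x = y"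
    and D_sym: "\<lbrakk>x \<in> V; y \<in> V\<rbrakk> \<Longrightarrow> D x y = D y x"
    and D_tri: "\<lbrakk>x \<in> V; y \<in> V; z \<in> V\<rbrakk> \<Longrightarrow> D x z \<le> D x y + D y z"
    and D_split: "\<lbrakk>x \<in> V; z \<in> V; D x z = i + j\<rbrakk> \<Longrightarrow> \<exists>y\<in>V. D x y = i \<and> D y z = j"
    and D_attained: "\<exists>x\<in>V. \<exists>y\<in>V. D x y = d"
    and card_up: "\<lbrakk>x \<in> V; y \<in> V\<rbrakk> \<Longrightarrow> int (card {w \<in> V. D y w = 1 \<and> D x w = D x y + 1}) = b (D x y)"
    and card_down: "\<lbrakk>x \<in> V; y \<in> V\<rbrakk> \<Longrightarrow> int (card {w \<in> V. D y w = 1 \<and> D x w + 1 = D x y}) = c (D x y)"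
begin

definition N :: "'a \<Rightarrow> 'a set" where "N y = {w \<in> V. D y w = 1}"

lemma N_V: "w \<in> N y \<Longrightarrow> w \<in> V"
  by (simp add: N_def)

lemma finite_N [simp]: "finite (N y)"
  using finite_V by (simp add: N_def)

lemma card_N_up: "\<lbrakk>x \<in> V; y \<in> V\<rbrakk> \<Longrightarrow> int (card {w \<in> N y. D x w = D x y + 1}) = b (D x y)"
  using card_up[of x y] by (simp add: N_def conj_assoc)

lemma card_N_down: "\<lbrakk>x \<in> V; y \<in> V\<rbrakk> \<Longrightarrow> int (card {w \<in> N y. D x w + 1 = D x y}) = c (D x y)"
  using card_down[of x y] by (simp add: N_def conj_assoc)

lemma N_dist:
  assumes "x \<in> V" "y \<in> V" "w \<in> N y"
  shows "D x w \<le> D x y + 1" "D x y \<le> D x w + 1"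
  using assms D_tri[of x y w] D_tri[of x w y] D_sym[of y w] by (auto simp: N_def)

lemma card_N:
  assumes "y \<in> V"
  shows "int (card (N y)) = b 0"
proof -
  have "N y = {w \<in> N y. D y w = D y y + 1}"
    using assms D_eq_0_iff[of y y] by (auto simp: N_def)
  then show ?thesis using card_N_up[of y y] assms D_eq_0_iff[of y y] by simp
qed

lemma card_N_level:
  assumes "x \<in> V" "y \<in> V"
  shows "int (card {w \<in> N y. D x w = D x y}) = b 0 - b (D x y) - c (D x y)"
proof -
  let ?U = "{w \<in> N y. D x w = D x y + 1}" and ?E = "{w \<in> N y. D x w = D x y}"
    and ?L = "{w \<in> N y. D x w + 1 = D x y}"
  have "D x w = D x y + 1 \<or> D x w = D x y \<or> D x w + 1 = D x y" if "w \<in> N y" for w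
    using N_dist[OF assms that] by linarith
  then have "N y = ?U \<union> ?E \<union> ?L" by blast
  then have "card (N y) = card (?U \<union> ?E \<union> ?L)" by simp
  also have "\<dots> = card ?U + card ?E + card ?L"
    by (subst card_Un_disjoint; (subst card_Un_disjoint)?) auto
  finally show ?thesis
    using card_N[OF assms(2)] card_N_up[OF assms] card_N_down[OF assms] by linarith
qed

text \<open>Across an edge the distance from \<open>x\<close> changes by at most 1, so only the
  neighbours counted by \<open>b\<close> and \<open>c\<close> contribute, with opposite
  signs.\<close>

lemma sum_N_dist:
  assumes "x \<in> V" "y \<in> V"
  shows "(\<Sum>w\<in>N y. int (D x w) - int (D x y)) = b (D x y) - c (D x y)"
proof -
  have "(\<Sum>w\<in>N y. int (D x w) - int (D x y)) =
     (\<Sum>w\<in>N y. of_bool (D x w = D x y + 1) - of_bool (D x w + 1 = D x y))"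
  proof (intro sum.cong refl)
    fix w assume "w \<in> N y"
    then show "int (D x w) - int (D x y) = of_bool (D x w = D x y + 1) - of_bool (D x w + 1 = D x y)"
      using N_dist[OF assms, of w] by (auto simp: of_bool_def)
  qed
  also have "\<dots> = int (card {w \<in> N y. D x w = D x y + 1}) - int (card {w \<in> N y. D x w + 1 = D x y})"
    by (simp add: sum_subtractf of_bool_def sum.If_cases Int_def)
  finally show ?thesis using card_N_up[OF assms] card_N_down[OF assms] by simp
qed

lemma ex_dist:
  assumes "i + j \<le> d"
  shows "\<exists>x\<in>V. \<exists>y\<in>V. \<exists>z\<in>V. D x y = i \<and> D y z = j \<and> D x z = i + j"
proof -
  obtain x w where xw: "x \<in> V" "w \<in> V" "D x w = (i + j) + (d - (i + j))"
    using D_attained assms by auto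
  then obtain z where z: "z \<in> V" "D x z = i + j" using D_split by metis
  then show ?thesis using D_split[of x z i j] xw by blast
qed

text \<open>For \<open>y\<close> on a geodesic from \<open>x\<close> to \<open>z\<close>, a
  neighbour of \<open>y\<close> nearer to \<open>z\<close> must be farther from \<open>x\<close>, or
  else \<open>x\<close> and \<open>z\<close> would be too close.\<close>

lemma c_le_b:
  assumes "i + j \<le> d"
  shows "c j \<le> b i"
proof -
  obtain x y z where V: "x \<in> V" "y \<in> V" "z \<in> V"
    and D: "D x y = i" "D y z = j" "D x z = i + j" using ex_dist[OF assms] by blast
  have D': "D z y = j" using D V D_sym by metis
  have "D x w = i + 1" if w: "w \<in> N y" "D z w + 1 = j" for w
    using N_dist[OF V(1,2) w(1)] D_tri[of x w z] D_sym[of w z] V D w N_V by fastforce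
  then have "{w \<in> N y. D z w + 1 = D z y} \<subseteq> {w \<in> N y. D x w = D x y + 1}"
    using D D' by auto
  then show ?thesis
    using card_N_up[OF V(1,2)] card_N_down[OF V(3,2)] D D'
    by (metis (no_types, lifting) card_mono finite_N finite_subset mem_Collect_eq of_nat_mono subsetI)
qed

lemma c_pos:
  assumes "0 < i" "i \<le> d"
  shows "0 < c i"
proof -
  obtain x y z where V: "x \<in> V" "y \<in> V" "z \<in> V"
    and D: "D x y = i - 1" "D y z = 1" "D x z = i" using ex_dist[of "i - 1" 1] assms by auto
  have "y \<in> {w \<in> N z. D x w + 1 = D x z}"
    using V D assms D_sym[of y z] by (auto simp: N_def)
  then have "0 < card {w \<in> N z. D x w + 1 = D x z}"
    by (auto simp only: card_gt_0_iff intro: finite_subset[OF _ finite_N[of z]])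
  then show ?thesis using card_N_down[OF V(1,3)] D(3) by (metis of_nat_0_less_iff)
qed

section \<open>Counts among the neighbours that are not nearer to the other end\<close>

definition far :: "'a \<Rightarrow> 'a \<Rightarrow> 'a set" where "far y z = {v \<in> N z. D y z \<le> D y v}"
definition level :: "'a \<Rightarrow> 'a \<Rightarrow> 'a set" where "level y z = {v \<in> N z. D y v = D y z}"

lemma finite_far [simp]: "finite (far y z)" and finite_level [simp]: "finite (level y z)"
  by (simp_all add: far_def level_def)

lemma level_subset_far: "level y z \<subseteq> far y z"
  by (auto simp: far_def level_def)

lemma card_level:
  assumes "y \<in> V" "z \<in> V"
  shows "int (card (level y z)) = b 0 - b (D y z) - c (D y z)"
  using card_N_level[OF assms] by (simp add: level_def)

text \<open>Splits off the neighbours on which \<open>f\<close> is constant; applied with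
  \<open>s\<close> equal to 1 around one end and -1 around the other.\<close>

lemma sum_N_far:
  assumes "y \<in> V" "z \<in> V"
    and "\<And>v. v \<in> N z \<Longrightarrow> D y v + 1 = D y z \<Longrightarrow> f v = (s::int)"
  shows "sum f (N z) = s * c (D y z) + sum f (far y z)"
proof -
  let ?L = "{v \<in> N z. D y v + 1 = D y z}"
  have "N z = ?L \<union> far y z" using N_dist[OF assms(1,2)] by (fastforce simp: far_def)
  then have "sum f (N z) = sum f (?L \<union> far y z)" by simp
  also have "\<dots> = sum f ?L + sum f (far y z)"
    by (intro sum.union_disjoint) (auto simp: far_def)
  also have "sum f ?L = (\<Sum>v\<in>?L. s)" by (intro sum.cong) (auto simp: assms(3))
  finally show ?thesis using card_N_down[OF assms(1,2)] by simp
qed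

text \<open>The neighbours of \<open>z\<close> nearer to \<open>u\<close> include all those nearer
  to \<open>y\<close>, since \<open>u\<close> is adjacent to \<open>y\<close>; the others lie in
  \<open>far y z\<close>.\<close>

lemma card_far_of_far:
  assumes V: "y \<in> V" "z \<in> V" and u: "u \<in> N y" "D u z = D y z + 1"
  shows "int (card {v \<in> far y z. D u v = D y z}) = c (D y z + 1) - c (D y z)"
proof -
  let ?L = "{v \<in> N z. D y v + 1 = D y z}" and ?F = "{v \<in> far y z. D u v = D y z}"
  have uV: "u \<in> V" using u N_V by blast
  have Dvu: "D v u \<le> D v y + 1" "D v y = D y v" "D v u = D u v" if "v \<in> V" for v
    using N_dist[OF that V(1) u(1)] D_sym[OF that] V uV by auto
  have *: "{v \<in> N z. D u v + 1 = D u z} = ?L \<union> ?F"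
    using N_dist[OF V] N_dist[OF uV V(2)] Dvu N_V u(2) by (fastforce simp: far_def)
  have "card {v \<in> N z. D u v + 1 = D u z} = card ?L + card ?F"
    unfolding * by (intro card_Un_disjoint) (auto simp: far_def)
  then show ?thesis using card_N_down[OF uV V(2)] card_N_down[OF V] u(2) by simp
qed

text \<open>Makes the neighbours of \<open>z\<close> nearer to \<open>y\<close> disjoint from those
  nearer to \<open>u\<close>, on which the next two counts rest.\<close>

lemma D_level_of_level:
  assumes V: "y \<in> V" "z \<in> V" and q: "D y z = q" "0 < q"
    and a0: "b 0 - b (q - 1) - c (q - 1) = 0"
    and u: "u \<in> N y" "D u z = q" and v: "v \<in> N z"
  shows "D y v + 1 = q \<Longrightarrow> D u v = q" and "D u v + 1 = q \<Longrightarrow> D y v = q"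
proof -
  have uV: "u \<in> V" and vV: "v \<in> V" using u v N_V by blast+
  \<comment> \<open>as \<open>a (q - 1) = 0\<close>, the adjacent vertices \<open>y\<close> and \<open>u\<close> are not both at distance \<open>q - 1\<close> from \<open>v\<close>\<close>
  have "int (card (level v y)) = 0" if "D v y = q - 1"
    using card_level[OF vV V(1)] a0 that by simp
  then have *: "\<not> (D v y = q - 1 \<and> D v u = q - 1)"
    using u(1) by (auto simp: level_def)
  have sym: "D v y = D y v" "D v u = D u v" using D_sym V uV vV by metis+
  show "D y v + 1 = q \<Longrightarrow> D u v = q" "D u v + 1 = q \<Longrightarrow> D y v = q"
    using * sym N_dist[OF vV V(1) u(1)] N_dist[OF V v] N_dist[OF uV V(2) v] q u(2) by linarith+
qed

text \<open>Restricting to \<open>level y z\<close> loses no neighbour of \<open>z\<close> nearer to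
  \<open>u\<close>.\<close>

lemma card_near_of_level:
  assumes V: "y \<in> V" "z \<in> V" and q: "D y z = q" "0 < q"
    and a0: "b 0 - b (q - 1) - c (q - 1) = 0"
    and u: "u \<in> N y" "D u z = q"
  shows "int (card {v \<in> level y z. D u v + 1 = q}) = c q"
proof -
  have uV: "u \<in> V" using u N_V by blast
  have "{v \<in> level y z. D u v + 1 = q} = {v \<in> N z. D u v + 1 = D u z}"
    using D_level_of_level(2)[OF assms] u(2) q by (auto simp: level_def)
  then show ?thesis using card_N_down[OF uV V(2)] u(2) by simp
qed

text \<open>The a_q neighbours of \<open>z\<close> at distance \<open>q\<close> from
  \<open>u\<close> include all c_q that are nearer to \<open>y\<close>; removing these leaves the
  part in \<open>far y z\<close>.\<close>

lemma card_far_of_level: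
  assumes V: "y \<in> V" "z \<in> V" and q: "D y z = q" "0 < q"
    and a0: "b 0 - b (q - 1) - c (q - 1) = 0"
    and u: "u \<in> N y" "D u z = q"
  shows "int (card {v \<in> far y z. D u v = q}) = b 0 - b q - c q - c q"
proof -
  let ?L = "{v \<in> N z. D y v + 1 = q}" and ?F = "{v \<in> far y z. D u v = q}"
  have uV: "u \<in> V" using u N_V by blast
  have *: "{v \<in> N z. D u v = D u z} = ?L \<union> ?F"
    using N_dist[OF V] D_level_of_level(1)[OF assms] u(2) q by (fastforce simp: far_def)
  have "card {v \<in> N z. D u v = D u z} = card ?L + card ?F"
    unfolding * using q by (intro card_Un_disjoint) (auto simp: far_def)
  then show ?thesis using card_N_level[OF uV V(2)] card_N_down[OF V] u(2) q by simp
qed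

end

section \<open>Double counting of pairs of neighbours\<close>

lemma sum_sum_edges:
  fixes f :: "'a \<Rightarrow> int" and g :: "'b \<Rightarrow> int"
  assumes "finite A" "finite B"
  shows "(\<Sum>u\<in>A. \<Sum>v\<in>{v\<in>B. R u v}. f u - g v)
    = (\<Sum>u\<in>A. int (card {v\<in>B. R u v}) * f u) - (\<Sum>v\<in>B. int (card {u\<in>A. R u v}) * g v)"
proof -
  have "(\<Sum>u\<in>A. \<Sum>v\<in>{v\<in>B. R u v}. g v) = (\<Sum>v\<in>B. \<Sum>u\<in>{u\<in>A. R u v}. g v)"
    by (rule sum.swap_restrict[OF assms])
  then show ?thesis by (simp add: sum_subtractf)
qed

context drg_metric
begin

text \<open>Two estimates are combined: 0 <= (a - c_q) F + e H and a <= F, where \<open>F\<close>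
  and \<open>H\<close> are the contributions of the level sets and of the rest. As e - (a - c_q) =
  c_{q+1} - a >= 0, they give e (F + H) >= (c_{q+1} - a) F >= a (c_{q+1} - a).\<close>

lemma sum_far_ge:
  assumes V: "x \<in> V" "y \<in> V" "z \<in> V" and q: "D y z = q" "0 < q" "q \<le> d"
    and a0: "b 0 - b (q - 1) - c (q - 1) = 0"
    and geo: "D x z = D x y + q"
    and a: "a = b 0 - b q - c q" and e: "e = c (q + 1) - c q" "0 < e" and ae: "a \<le> c (q + 1)"
  shows "e * ((\<Sum>u\<in>far z y. int (D x u) - int (D x y)) - (\<Sum>v\<in>far y z. int (D x v) - int (D x z)))
    \<ge> a * (c (q + 1) - a)"
proof -
  define f where "f u = int (D x u) - int (D x y)" for u
  define g where "g v = int (D x v) - int (D x z)" for v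
  \<comment> \<open>\<open>X\<close>, \<open>A\<close>, \<open>B\<close> lie around \<open>y\<close>
    and \<open>Y\<close>, \<open>A'\<close>, \<open>B'\<close> around \<open>z\<close>. The distance
    to the opposite end is \<open>q\<close> on \<open>A\<close>, \<open>A'\<close> and
    \<open>q + 1\<close> on \<open>B\<close>, \<open>B'\<close>.\<close>
  define X Y A A' where "X = far z y" and "Y = far y z" and "A = level z y" and "A' = level y z"
  define B B' where "B = X - A" and "B' = Y - A'"
  note defs = X_def Y_def A_def A'_def
  have q': "D z y = q" using q D_sym V by metis
  have fin: "finite X" "finite Y" "finite A" "finite A'" by (simp_all add: defs)
  have sub: "A \<subseteq> X" "A' \<subseteq> Y" by (simp_all add: defs level_subset_far)
  have XV: "u \<in> N y" "u \<in> V" if "u \<in> X" for u using that N_V by (auto simp: defs far_def)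
  have YV: "v \<in> N z" "v \<in> V" if "v \<in> Y" for v using that N_V by (auto simp: defs far_def)
  have X_split: "sum h X = sum h A + sum h B" for h :: "'a \<Rightarrow> int"
    using sum.subset_diff[OF sub(1) fin(1), of h] by (simp add: B_def)
  have Y_split: "sum h Y = sum h A' + sum h B'" for h :: "'a \<Rightarrow> int"
    using sum.subset_diff[OF sub(2) fin(2), of h] by (simp add: B'_def)
  have Au: "D u z = q" if "u \<in> A" for u
    using that q' D_sym[of u z] V N_V by (auto simp: defs level_def)
  have A'v: "D v y = q" if "v \<in> A'" for v
    using that q D_sym[of v y] V N_V by (auto simp: defs level_def)
  have Bu: "D u z = q + 1" if "u \<in> B" for u
  proof -
    have "u \<in> X" "D z u \<noteq> q" "q \<le> D z u" using that q' by (auto simp: B_def defs far_def level_def)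
    then show ?thesis using N_dist[OF V(3,2) XV(1)] q' D_sym[of u z] V XV by fastforce
  qed
  have B'v: "D v y = q + 1" if "v \<in> B'" for v
  proof -
    have "v \<in> Y" "D y v \<noteq> q" "q \<le> D y v" using that q by (auto simp: B'_def defs far_def level_def)
    then show ?thesis using N_dist[OF V(2,3) YV(1)] q D_sym[of v y] V YV by fastforce
  qed
  have symXY: "D u v = D v u" if "u \<in> X" "v \<in> Y" for u v using that XV YV D_sym by blast
  have degA: "int (card {v \<in> Y. D u v = q}) = a - c q" if "u \<in> A" for u
    using card_far_of_level[OF V(2,3) q(1,2) a0, of u] that sub XV Au a by (auto simp: defs)
  have degA': "int (card {u \<in> X. D u v = q}) = a - c q" if "v \<in> A'" for v
  proof -
    have "v \<in> Y" using that sub by blast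
    then have "{u \<in> X. D u v = q} = {u \<in> X. D v u = q}"
      by (intro Collect_cong conj_cong refl) (metis symXY)
    then show ?thesis
      using card_far_of_level[OF V(3,2) q' q(2) a0, of v] that sub YV A'v a by (auto simp: defs)
  qed
  have degB: "int (card {v \<in> Y. D u v = q}) = e" if "u \<in> B" for u
    using card_far_of_far[OF V(2,3), of u] that XV Bu e q by (auto simp: defs B_def)
  have degB': "int (card {u \<in> X. D u v = q}) = e" if "v \<in> B'" for v
  proof -
    have "{u \<in> X. D u v = q} = {u \<in> X. D v u = q}"
      using that unfolding B'_def by (intro Collect_cong conj_cong refl) (metis symXY DiffD1)
    then show ?thesis
      using card_far_of_far[OF V(3,2), of v] that YV B'v e q' by (auto simp: defs B'_def)
  qed
  have nearA: "int (card {v \<in> A'. D u v + 1 = q}) = c q" if "u \<in> A" for u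
    using card_near_of_level[OF V(2,3) q(1,2) a0, of u] that sub XV Au by (auto simp: defs)
  have nearA': "int (card {u \<in> A. D u v + 1 = q}) = c q" if "v \<in> A'" for v
  proof -
    have "v \<in> Y" using that sub by blast
    then have "{u \<in> A. D u v + 1 = q} = {u \<in> A. D v u + 1 = q}"
      using sub by (intro Collect_cong conj_cong refl) (metis symXY subsetD)
    then show ?thesis
      using card_near_of_level[OF V(3,2) q' q(2) a0, of v] that sub YV A'v by (auto simp: defs)
  qed
  \<comment> \<open>One triangle inequality yields both bounds: 0 for pairs at distance
    \<open>q\<close> and 1 at distance \<open>q - 1\<close>.\<close>
  have fg: "f u - g v \<ge> int q - int (D u v)" if "u \<in> X" "v \<in> Y" for u v
    using D_tri[of x u v] V XV YV that geo by (auto simp: f_def g_def)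
  define F where "F = sum f A - sum g A'"
  define H where "H = sum f B - sum g B'"
  have "0 \<le> (\<Sum>u\<in>X. \<Sum>v\<in>{v\<in>Y. D u v = q}. f u - g v)"
    using fg by (intro sum_nonneg) fastforce
  also have "\<dots> = (\<Sum>u\<in>X. int (card {v\<in>Y. D u v = q}) * f u)
      - (\<Sum>v\<in>Y. int (card {u\<in>X. D u v = q}) * g v)"
    by (rule sum_sum_edges) (use fin in auto)
  also have "\<dots> = ((a - c q) * sum f A + e * sum f B) - ((a - c q) * sum g A' + e * sum g B')"
    unfolding X_split Y_split by (simp add: degA degA' degB degB' sum_distrib_left)
  finally have H: "0 \<le> (a - c q) * F + e * H" by (simp add: F_def H_def algebra_simps)
  \<comment> \<open>There are \<open>c q * a\<close> pairs at distance \<open>q - 1\<close> between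
    \<open>A\<close> and \<open>A'\<close>, each contributing at least 1; regularity on both sides
    turns their sum into \<open>c q * F\<close>.\<close>
  have "c q * a = (\<Sum>u\<in>A. \<Sum>v\<in>{v\<in>A'. D u v + 1 = q}. 1)"
    using card_level[OF V(3,2)] q' a by (simp add: nearA[simplified] flip: A_def)
  also have "\<dots> \<le> (\<Sum>u\<in>A. \<Sum>v\<in>{v\<in>A'. D u v + 1 = q}. f u - g v)"
    using fg sub by (intro sum_mono) fastforce
  also have "\<dots> = (\<Sum>u\<in>A. int (card {v\<in>A'. D u v + 1 = q}) * f u)
      - (\<Sum>v\<in>A'. int (card {u\<in>A. D u v + 1 = q}) * g v)"
    by (rule sum_sum_edges) (use fin in auto)
  also have "\<dots> = c q * F"
    by (simp add: nearA[simplified] nearA'[simplified] F_def sum_distrib_left right_diff_distrib)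
  finally have F: "a \<le> F" using c_pos[OF q(2,3)] by simp
  have "a * (c (q + 1) - a) \<le> F * (c (q + 1) - a)" using F ae by (intro mult_right_mono) auto
  also have "\<dots> \<le> e * (F + H)" using H unfolding e(1) by (simp add: algebra_simps)
  also have "F + H = sum f X - sum g Y" by (simp add: F_def H_def X_split Y_split)
  finally show ?thesis by (simp add: f_def g_def defs)
qed

section \<open>Descent of b_i - c_i and the diameter bound\<close>

lemma b_minus_c_step:
  assumes q: "0 < q" "q \<le> d" and iq: "i + q \<le> d"
    and a0: "b 0 - b (q - 1) - c (q - 1) = 0"
    and a: "a = b 0 - b q - c q" and e: "c q < c (q + 1)" and ae: "a \<le> c (q + 1)"
    and M: "M = \<lceil>real_of_int (a * (c (q + 1) - a)) / real_of_int (c (q + 1) - c q)\<rceil>"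
  shows "b (i + q) - c (i + q) + (2 * c q + M) \<le> b i - c i"
proof -
  obtain x y z where V: "x \<in> V" "y \<in> V" "z \<in> V"
    and D: "D x y = i" "D y z = q" "D x z = i + q" using ex_dist[OF iq] by blast
  have D': "D z y = q" using D V D_sym by metis
  let ?f = "\<lambda>u. int (D x u) - int (D x y)" and ?g = "\<lambda>v. int (D x v) - int (D x z)"
  \<comment> \<open>On a geodesic from \<open>x\<close> through \<open>y\<close> to
    \<open>z\<close>, a step from \<open>y\<close> towards \<open>z\<close> leads away from
    \<open>x\<close>, and a step from \<open>z\<close> towards \<open>y\<close> leads towards
    \<open>x\<close>.\<close>
  have f1: "?f u = 1" if "u \<in> N y" "D z u + 1 = D z y" for u
    using N_dist[OF V(1,2) that(1)] D_tri[of x u z] D_sym[of u z] N_V V that D D' by fastforce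
  have g1: "?g v = -1" if "v \<in> N z" "D y v + 1 = D y z" for v
    using N_dist[OF V(1,3) that(1)] D_tri[of x y v] N_V V that D by fastforce
  define T where "T = sum ?f (far z y) - sum ?g (far y z)"
  have "b i - c i = c q + sum ?f (far z y)"
    using sum_N_dist[OF V(1,2)] sum_N_far[OF V(3,2), of ?f 1] f1 D D' by simp
  moreover have "b (i + q) - c (i + q) = - c q + sum ?g (far y z)"
    using sum_N_dist[OF V(1,3)] sum_N_far[OF V(2,3), of ?g "-1"] g1 D by simp
  \<comment> \<open>\<open>T\<close> is an integer, so its lower bound may be rounded up.\<close>
  moreover have "M \<le> T"
  proof -
    have "a * (c (q + 1) - a) \<le> (c (q + 1) - c q) * T"
      unfolding T_def using sum_far_ge[OF V D(2) q a0 _ a refl _ ae] D e by simp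
    then have "real_of_int (a * (c (q + 1) - a)) \<le> real_of_int T * real_of_int (c (q + 1) - c q)"
      by (metis mult.commute of_int_le_iff of_int_mult)
    then show ?thesis unfolding M using e by (simp add: ceiling_le_iff pos_divide_le_eq)
  qed
  ultimately show ?thesis unfolding T_def by linarith
qed

lemma b_minus_c_steps:
  assumes step: "\<And>i. i + q \<le> d \<Longrightarrow> b (i + q) - c (i + q) + m \<le> b i - c i"
    and "p + n * q \<le> d"
  shows "b (p + n * q) - c (p + n * q) + int n * m \<le> b p - c p"
  using assms(2)
proof (induction n)
  case (Suc n)
  then show ?case using step[of "p + n * q"] by (simp add: algebra_simps)
qed simp

lemma diameter_bound:
  assumes q: "0 < q" "q < d"
    and a0: "b 0 - b (q - 1) - c (q - 1) = 0"
    and a: "a = b 0 - b q - c q" and e: "c q < c (q + 1)" and ae: "a \<le> c (q + 1)"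
    and M: "M = \<lceil>real_of_int (a * (c (q + 1) - a)) / real_of_int (c (q + 1) - c q)\<rceil>"
    and p: "2 * p \<le> d"
  shows "int d \<le> 2 * int p - 1
    + (\<lfloor>real_of_int (2 * (b p - c p)) / real_of_int (2 * c q + M)\<rfloor> + 1) * int q"
proof -
  let ?m = "2 * c q + M" and ?t = "\<lfloor>real_of_int (2 * (b p - c p)) / real_of_int (2 * c q + M)\<rfloor>"
  \<comment> \<open>The largest number of steps of length \<open>q\<close> from \<open>p\<close>
    that do not pass \<open>d - p\<close>.\<close>
  define n where "n = (d - 2 * p) div q"
  have nq: "n * q \<le> d - 2 * p" "d - 2 * p < (n + 1) * q"
    using dividend_less_div_times[OF q(1), of "d - 2 * p"] by (auto simp: n_def)
  \<comment> \<open>As the size of a level set, \<open>a\<close> is nonnegative; hence so is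
    \<open>M\<close>, and the divisor is positive because \<open>c q\<close> is.\<close>
  have "0 \<le> a"
  proof -
    obtain y z where "y \<in> V" "z \<in> V" "D y z = q" using ex_dist[of 0 q] q by auto
    then show ?thesis using card_level[of y z] a by simp
  qed
  then have "0 \<le> real_of_int (a * (c (q + 1) - a)) / real_of_int (c (q + 1) - c q)"
    using e ae by (intro divide_nonneg_nonneg) auto
  then have "0 \<le> M" unfolding M by linarith
  then have m: "0 < ?m" using c_pos[of q] q by simp
  have "b (p + n * q) - c (p + n * q) + int n * ?m \<le> b p - c p"
    using b_minus_c_step[OF _ _ _ a0 a e ae M] q nq p by (intro b_minus_c_steps) auto
  \<comment> \<open>Both hold because p + (p + n q) <= d; together they bound the final value below
    by -(b_p - c_p).\<close>
  moreover have "c (p + n * q) \<le> b p" "c p \<le> b (p + n * q)"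
    using nq p by (auto intro!: c_le_b)
  ultimately have "int n * ?m \<le> 2 * (b p - c p)" by simp
  then have "real_of_int (int n) * real_of_int ?m \<le> real_of_int (2 * (b p - c p))"
    by (metis of_int_le_iff of_int_mult)
  then have "int n \<le> ?t" using m by (simp add: le_floor_iff pos_le_divide_eq)
  then have "(int n + 1) * int q \<le> (?t + 1) * int q" by (intro mult_right_mono) auto
  \<comment> \<open>Strictness here produces the -1 in the bound.\<close>
  moreover have "int (d - 2 * p) < (int n + 1) * int q"
    using nq(2) by (metis of_nat_1 of_nat_add of_nat_less_iff of_nat_mult)
  ultimately show ?thesis using p by linarith
qed

end

section \<open>Graph distance as an instance of the metric setting\<close>

context pair_graph
begin

lemma gdist_le: "awalk x p y \<Longrightarrow> gdist G x y \<le> length p"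
  unfolding gdist_def by (auto intro: Least_le)

lemma gdist_walk:
  assumes "awalk x p y"
  obtains r where "awalk x r y" "length r = gdist G x y"
  using LeastI[of "\<lambda>n. \<exists>p. awalk x p y \<and> length p = n" "length p"] assms
  unfolding gdist_def by blast

lemma gdist_sym: "gdist G x y = gdist G y x"
proof -
  have len: "length (rev_path p) = length p" for p :: "('a \<times> 'a) list" by (induction p) auto
  have "(\<exists>p. awalk x p y \<and> length p = n) \<longleftrightarrow> (\<exists>p. awalk y p x \<and> length p = n)" for n
    by (metis awalk_rev_path len)
  then show ?thesis unfolding gdist_def by simp
qed

text \<open>Connectedness refers to the symmetric closure of the digraph, which has the same
  reachability because the arcs are already symmetric.\<close>

lemma connected_walk:
  assumes "Digraph_Component.connected (with_proj G)" "x \<in> pverts G" "y \<in> pverts G"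
  obtains r where "awalk x r y" "length r = gdist G x y"
proof -
  have "x \<rightarrow>\<^sup>*\<^bsub>with_proj (mk_symmetric (with_proj G))\<^esub> y"
    using assms by (auto simp: connected_def strongly_connected_def)
  then have "x \<rightarrow>\<^sup>*\<^bsub>with_proj G\<^esub> y"
    using reachable_mk_symmetric_eq[OF pair_sym_arcs] by simp
  then show ?thesis using that gdist_walk reachable_awalk by metis
qed

end

lemma drg_metric_of_distance_regular:
  assumes "distance_regular G b c"
  shows "drg_metric (pverts G) (gdist G) b c (diameter G)"
proof -
  interpret pair_graph G using assms by (simp add: distance_regular_def)
  have conn: "Digraph_Component.connected (with_proj G)"
    using assms by (simp add: distance_regular_def)
  let ?S = "{gdist G x y | x y. x \<in> pverts G \<and> y \<in> pverts G}"
  have "?S = (\<lambda>(x, y). gdist G x y) ` (pverts G \<times> pverts G)" by auto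
  then have fin: "finite ?S" using pair_finite_verts by simp
  have ne: "?S \<noteq> {}" using conn by (fastforce simp: connected_def strongly_connected_def)
  have le: "gdist G x y \<le> diameter G" if "x \<in> pverts G" "y \<in> pverts G" for x y
    unfolding diameter_def using that fin by (intro Max_ge) auto
  have tri: "gdist G x z \<le> gdist G x y + gdist G y z"
    if "x \<in> pverts G" "y \<in> pverts G" "z \<in> pverts G" for x y z
  proof -
    obtain r where "awalk x r y" "length r = gdist G x y"
      using connected_walk[OF conn \<open>x \<in> _\<close> \<open>y \<in> _\<close>] .
    moreover obtain s where "awalk y s z" "length s = gdist G y z"
      using connected_walk[OF conn \<open>y \<in> _\<close> \<open>z \<in> _\<close>] .
    ultimately
    show ?thesis using gdist_le[of x "r @ s" z] awalk_appendI[of x r y s z] by simp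
  qed
  show ?thesis
  proof
    show "finite (pverts G)" by (rule pair_finite_verts)
    show "gdist G x y = 0 \<longleftrightarrow> x = y" if xy: "x \<in> pverts G" "y \<in> pverts G" for x y
    proof -
      obtain r where "awalk x r y" "length r = gdist G x y" using connected_walk[OF conn xy] .
      moreover have "awalk x [] x" using xy by (simp add: awalk_Nil_iff)
      ultimately show ?thesis using gdist_le[of x "[]" x] by (auto simp: awalk_Nil_iff)
    qed
    show "gdist G x y = gdist G y x" for x y by (rule gdist_sym)
    show "gdist G x z \<le> gdist G x y + gdist G y z"
      if "x \<in> pverts G" "y \<in> pverts G" "z \<in> pverts G" for x y z using tri that .
    show "\<exists>y\<in>pverts G. gdist G x y = i \<and> gdist G y z = j"
      if xz: "x \<in> pverts G" "z \<in> pverts G" and ij: "gdist G x z = i + j" for x z i j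
    proof -
      obtain r where r: "awalk x r z" "length r = i + j" using connected_walk[OF conn xz] ij by metis
      \<comment> \<open>A shortest walk is cut after \<open>i\<close> arcs; the pieces bound the two
        distances above, and the triangle inequality forces equality.\<close>
      then have "awalk x (take i r @ drop i r) z" by simp
      then obtain y where y: "awalk x (take i r) y" "awalk y (drop i r) z"
        unfolding awalk_append_iff by blast
      then have yV: "y \<in> pverts G" using awalk_hd_in_verts by blast
      have "gdist G x y \<le> i" "gdist G y z \<le> j" using gdist_le[OF y(1)] gdist_le[OF y(2)] r by auto
      then show ?thesis using tri[OF xz(1) yV xz(2)] ij yV by (intro bexI[of _ y]) auto
    qed
    show "\<exists>x\<in>pverts G. \<exists>y\<in>pverts G. gdist G x y = diameter G"
      using Max_in[OF fin ne] unfolding diameter_def by (auto 4 3)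
    fix x y assume xy: "x \<in> pverts G" "y \<in> pverts G"
    have bc: "int (card (gsphere G (int (gdist G x y) + 1) x \<inter> gsphere G 1 y)) = b (gdist G x y)"
        "int (card (gsphere G (int (gdist G x y) - 1) x \<inter> gsphere G 1 y)) = c (gdist G x y)"
      using assms xy le[OF xy] by (auto simp: distance_regular_def)
    have "gsphere G (int (gdist G x y) + 1) x \<inter> gsphere G 1 y
        = {w \<in> pverts G. gdist G y w = 1 \<and> gdist G x w = gdist G x y + 1}"
      by (auto simp: gsphere_def)
    then show "int (card {w \<in> pverts G. gdist G y w = 1 \<and> gdist G x w = gdist G x y + 1}) = b (gdist G x y)"
      using bc by simp
    have "gsphere G (int (gdist G x y) - 1) x \<inter> gsphere G 1 y
        = {w \<in> pverts G. gdist G y w = 1 \<and> gdist G x w + 1 = gdist G x y}"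
      by (auto simp: gsphere_def)
    then show "int (card {w \<in> pverts G. gdist G y w = 1 \<and> gdist G x w + 1 = gdist G x y}) = c (gdist G x y)"
      using bc by simp
  qed
qed

theorem theorem1p5:
  fixes G :: "'a pair_pre_digraph"
    and a b c :: "nat \<Rightarrow> int"
    and k M :: int
    and d p q :: nat
  assumes "distance_regular G b c"
    and "d = diameter G"
    and "k = b 0"
    and "\<And>i. i \<le> d \<Longrightarrow> a i = k - b i - c i"
    and "1 \<le> q" and "q \<le> d - 1"
    and "a (q - 1) = 0"
    and "c (q + 1) > c q"
    and "c (q + 1) \<ge> a q"
    and "M = \<lceil>real_of_int (a q * (c (q + 1) - a q)) / real_of_int (c (q + 1) - c q)\<rceil>"
    and "p \<le> d"
  shows "int d \<le> 2 * int p - 1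
     + max 0 ((\<lfloor>real_of_int (2 * (b p - c p)) / real_of_int (2 * c q + M)\<rfloor> + 1) * int q)"
proof (cases "2 * p \<le> d")
  case True
  interpret drg_metric "pverts G" "gdist G" b c d
    unfolding \<open>d = diameter G\<close> by (rule drg_metric_of_distance_regular[OF assms(1)])
  have q: "0 < q" "q < d" using assms(5,6) by auto
  have "b 0 - b (q - 1) - c (q - 1) = 0" "a q = b 0 - b q - c q"
    using assms(3,4,7) q by auto
  from diameter_bound[OF q this assms(8,9,10) True] show ?thesis by linarith
\<comment> \<open>If d < 2p, then 2p - 1 already suffices, since the maximum is nonnegative.\<close>
qed linarith

end
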